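(* Let $\mathcal{K}\subsetneqq\mathbb{R}^m$ be a regular cone, let $f\in\mathcal{B}_\theta(\mathcal{K})$ for some $\theta\ge1$, let $\mathsf{A}:\mathbb{R}^n\to\mathbb{R}^m$ be a linear operator, and let $h:\mathbb{R}^n\to\mathbb{R}\cup\{+\infty\}$ be proper, closed and convex, with $\mathcal{X}:=\operatorname{dom}h$ nonempty, convex and compact, and $\mathsf{A}(\mathcal{X})\cap\operatorname{dom}f\neq\emptyset$. Consider the generalized Frank-Wolfe method (Algorithm 1) for $\min_{x\in\mathbb{R}^n}f(\mathsf{A}x)+h(x)$ and the mirror descent method (Algorithm 2) for the dual problem $-\min_{y\in\mathbb{R}^m}[f^*(y)+h^*(-\mathsf{A}^*y)]$, both described in the context. Algorithms 1 and 2 are equivalent in the following sense: if the starting points $x^0$ in Algorithm 1 and $z^0$ in Algorithm 2 satisfy $x^0=z^0$ and $y^0=\nabla f(\mathsf{A}x^0)$, then an iterate sequence of either algorithm exactly corresponds to an iterate sequence of the other.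
   Context: A cone $\mathcal{K}\subsetneqq\mathbb{R}^m$ is regular if it is closed, convex, pointed (contains no line) and has nonempty interior. For $\theta\ge1$, $f\in\mathcal{B}_\theta(\mathcal{K})$ means that $f:\mathbb{R}^m\to\mathbb{R}\cup\{+\infty\}$ is a $\theta$-logarithmically-homogeneous (non-degenerate) self-concordant barrier on $\mathcal{K}$: $f$ is convex with $\operatorname{dom}f=\operatorname{int}\mathcal{K}$, is three-times differentiable and strictly convex on $\operatorname{int}\mathcal{K}$, and, with $H(u)$ the Hessian of $f$ at $u$, satisfies: (P1) $|D^3f(u)[w,w,w]|\le2\langle H(u)w,w\rangle^{3/2}$ for all $u\in\operatorname{int}\mathcal{K}$, $w\in\mathbb{R}^m$; (P2) $f(u_k)\to\infty$ for any $\{u_k\}_{k\ge1}\subseteq\operatorname{int}\mathcal{K}$ with $u_k\to u\in\operatorname{bd}\mathcal{K}$; (P3) $f(tu)=f(u)-\theta\ln t$ for all $u\in\operatorname{int}\mathcal{K}$, $t>0$. Notation: $\|w\|_u:=\sqrt{\langle w,H(u)w\rangle}$ for $u\in\operatorname{int}\mathcal{K}$; $\mathsf{A}^*$ is the adjoint of $\mathsf{A}$; $f^*,h^*$ are the Fenchel conjugates of $f,h$ ($w^*(g):=\sup_u\{\langle g,u\rangle-w(u)\}$); $\mathcal{K}^\circ:=\{y\in\mathbb{R}^m:\langle y,u\rangle\le0\ \forall u\in\mathcal{K}\}$ is the polar of $\mathcal{K}$; $f^*$ is a $\theta$-logarithmically-homogeneous self-concordant barrier on $\mathcal{K}^\circ$.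 $D_{f^*}(y,y^k):=f^*(y)-f^*(y^k)-\langle\nabla f^*(y^k),y-y^k\rangle$. $d(y):=f^*(y)+h^*(-\mathsf{A}^*y)$. Algorithm 1. Input: $x^0\in\mathcal{X}\cap\mathsf{A}^{-1}(\operatorname{dom}f)$. At iteration $k=0,1,\ldots$: 1. Compute $\nabla f(\mathsf{A}x^k)$ and $v^k\in\arg\min_{x\in\mathbb{R}^n}\langle\nabla f(\mathsf{A}x^k),\mathsf{A}x\rangle+h(x)$. 2. Compute $G_k:=\langle\nabla f(\mathsf{A}x^k),\mathsf{A}(x^k-v^k)\rangle+h(x^k)-h(v^k)$ and $D_k:=\|\mathsf{A}(v^k-x^k)\|_{\mathsf{A}x^k}$, and the step-size $\alpha_k:=\min\left\{\frac{G_k}{D_k(G_k+D_k)},1\right\}$. 3. Update $x^{k+1}:=x^k+\alpha_k(v^k-x^k)$. Algorithm 2. Input: $y^0\in\operatorname{int}\mathcal{K}^\circ$ and $z^0\in\{z\in\mathcal{X}:\mathsf{A}z=\nabla f^*(y^0)\}$. At iteration $k=0,1,\ldots$: 1. Let $s^k\in\partial h^*(-\mathsf{A}^*y^k)$ and define $g^k:=\nabla f^*(y^k)-\mathsf{A}s^k\in\partial d(y^k)$. 2. If $k\ge1$, compute $z^k:=(1-\gamma_{k-1})z^{k-1}+\gamma_{k-1}s^{k-1}$. 3. Compute $\bar G_k:=\langle g^k,y^k\rangle+h(z^k)-h(s^k)$ and $\bar D_k:=\|g^k\|_{\nabla f^*(y^k)}$, and the step-size $\gamma_k:=\min\left\{\frac{\bar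 G_k}{\bar D_k(\bar G_k+\bar D_k)},1\right\}$. 4. Update $y^{k+1}:=\arg\min_{y\in\mathbb{R}^m}\langle g^k,y\rangle+\gamma_k^{-1}D_{f^*}(y,y^k)$. *)

theory Defs
  imports "HOL-Analysis.Analysis"
begin

section \<open>Extended-real-valued convex functions\<close>

definition edom :: "('a \<Rightarrow> ereal) \<Rightarrow> 'a set" where
  "edom w = {u. w u < \<infinity>}"

definition proper :: "('a \<Rightarrow> ereal) \<Rightarrow> bool" where
  "proper w \<longleftrightarrow> (\<forall>u. w u \<noteq> -\<infinity>) \<and> edom w \<noteq> {}"

definition epi :: "('a \<Rightarrow> ereal) \<Rightarrow> ('a \<times> real) set" where
  "epi w = {(u, r). w u \<le> ereal r}"

definition convex_fun :: "('a::real_vector \<Rightarrow> ereal) \<Rightarrow> bool" where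
  "convex_fun w \<longleftrightarrow> convex (epi w)"

definition closed_fun :: "('a::topological_space \<Rightarrow> ereal) \<Rightarrow> bool" where
  "closed_fun w \<longleftrightarrow> closed (epi w)"

definition fenchel :: "('a::real_inner \<Rightarrow> ereal) \<Rightarrow> 'a \<Rightarrow> ereal" where
  "fenchel w g = (SUP u. ereal (g \<bullet> u) - w u)"

definition subdiff :: "('a::real_inner \<Rightarrow> ereal) \<Rightarrow> 'a \<Rightarrow> 'a set" where
  "subdiff w u = {s. \<bar>w u\<bar> \<noteq> \<infinity> \<and> (\<forall>v. w u + ereal (s \<bullet> (v - u)) \<le> w v)}"

section \<open>Derivatives\<close>

text \<open>The derivatives are those of the real-valued function obtained with
  \<^const>\<open>real_of_ereal\<close>.  They are meaningful at interior points of the domain.\<close>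

definition gradient :: "('a::real_inner \<Rightarrow> ereal) \<Rightarrow> 'a \<Rightarrow> 'a" where
  "gradient w u = (THE g. GDERIV (\<lambda>v. real_of_ereal (w v)) u :> g)"

definition hessian :: "(real^'m \<Rightarrow> ereal) \<Rightarrow> real^'m \<Rightarrow> real^'m^'m" where
  "hessian w u = jacobian (gradient w) (at u)"

text \<open>The trilinear form $D^3 w(u)$ on the diagonal, as the derivative of the matrix-valued
  map \<^term>\<open>hessian w\<close> in direction \<open>p\<close>, applied as a quadratic form to \<open>p\<close>.\<close>

definition third_deriv_diag :: "(real^'m \<Rightarrow> ereal) \<Rightarrow> real^'m \<Rightarrow> real^'m \<Rightarrow> real" where
  "third_deriv_diag w u p = (frechet_derivative (hessian w) (at u) p *v p) \<bullet> p"

definition local_norm :: "(real^'m \<Rightarrow> ereal) \<Rightarrow> real^'m \<Rightarrow> real^'m \<Rightarrow> real" where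
  "local_norm w u p = sqrt (p \<bullet> (hessian w u *v p))"

definition three_times_differentiable_on ::
    "(real^'m \<Rightarrow> ereal) \<Rightarrow> (real^'m) set \<Rightarrow> bool" where
  "three_times_differentiable_on w S \<longleftrightarrow> (\<forall>u\<in>S.
     (\<lambda>v. real_of_ereal (w v)) differentiable (at u) \<and>
     gradient w differentiable (at u) \<and>
     hessian w differentiable (at u))"

definition bregman :: "('a::real_inner \<Rightarrow> ereal) \<Rightarrow> 'a \<Rightarrow> 'a \<Rightarrow> ereal" where
  "bregman w y y' = w y - w y' - ereal (gradient w y' \<bullet> (y - y'))"

section \<open>Cones and barriers\<close>

definition regular_cone :: "'a::euclidean_space set \<Rightarrow> bool" where
  "regular_cone K \<longleftrightarrow> cone K \<and> K \<noteq> UNIV \<and> closed K \<and> convex K \<and>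
     (\<nexists>a d. d \<noteq> 0 \<and> (\<forall>t::real. a + t *\<^sub>R d \<in> K)) \<and> interior K \<noteq> {}"

definition polar_cone :: "'a::real_inner set \<Rightarrow> 'a set" where
  "polar_cone K = {y. \<forall>u\<in>K. y \<bullet> u \<le> 0}"

definition strictly_convex_on :: "'a::real_vector set \<Rightarrow> ('a \<Rightarrow> ereal) \<Rightarrow> bool" where
  "strictly_convex_on S w \<longleftrightarrow> (\<forall>u\<in>S. \<forall>v\<in>S. \<forall>t::real. u \<noteq> v \<and> 0 < t \<and> t < 1 \<longrightarrow>
     w ((1 - t) *\<^sub>R u + t *\<^sub>R v) < ereal (1 - t) * w u + ereal t * w v)"

definition lh_sc_barrier :: "real \<Rightarrow> (real^'m) set \<Rightarrow> (real^'m \<Rightarrow> ereal) \<Rightarrow> bool" where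
  "lh_sc_barrier \<theta> K f \<longleftrightarrow>
     (\<forall>u. f u \<noteq> -\<infinity>) \<and> convex_fun f \<and> edom f = interior K \<and>
     three_times_differentiable_on f (interior K) \<and>
     strictly_convex_on (interior K) f \<and>
     (\<forall>u\<in>interior K. \<forall>w. \<bar>third_deriv_diag f u w\<bar> \<le> 2 * ((hessian f u *v w) \<bullet> w) powr (3/2)) \<and>
     (\<forall>s u. (\<forall>k::nat. s k \<in> interior K) \<and> s \<longlonglongrightarrow> u \<and> u \<in> frontier K \<longrightarrow>
        (\<lambda>k. f (s k)) \<longlonglongrightarrow> \<infinity>) \<and>
     (\<forall>u\<in>interior K. \<forall>t>0. f (t *\<^sub>R u) = f u - ereal (\<theta> * ln t))"

section \<open>The two algorithms\<close>

text \<open>The quotient is taken in \<^typ>\<open>ereal\<close>, where \<open>c / 0 = \<infinity>\<close> for \<open>c > 0\<close> and \<open>0 / 0 = 0\<close>.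
  Hence a vanishing local norm with a positive gap gives the full step, and a zero gap gives
  step 0.\<close>

definition step_size :: "real \<Rightarrow> real \<Rightarrow> real" where
  "step_size G D = real_of_ereal (min (ereal G / ereal (D * (G + D))) 1)"

lemma step_size_regular:
  assumes "0 \<le> G" "0 < D"
  shows "step_size G D = min (G / (D * (G + D))) 1"
proof -
  have "D * (G + D) \<noteq> 0" using assms by auto
  then have "ereal G / ereal (D * (G + D)) = ereal (G / (D * (G + D)))"
    by simp
  then show ?thesis
    by (simp add: step_size_def one_ereal_def flip: ereal_min del: ereal_divide)
qed

lemma step_size_zero_norm: "0 < G \<Longrightarrow> step_size G 0 = 1"
  by (simp add: step_size_def divide_ereal_def min_def)

lemma step_size_zero_gap: "step_size 0 D = 0"
  by (simp add: step_size_def divide_ereal_def min_def flip: zero_ereal_def)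

text \<open>A run consists of the iterates together with all auxiliary quantities.
  The gaps are real numbers, the right-hand sides defining them are computed in \<^typ>\<open>ereal\<close>.\<close>

definition frank_wolfe_run ::
    "(real^'m \<Rightarrow> ereal) \<Rightarrow> (real^'n \<Rightarrow> real^'m) \<Rightarrow> (real^'n \<Rightarrow> ereal) \<Rightarrow>
     (nat \<Rightarrow> real^'n) \<Rightarrow> (nat \<Rightarrow> real^'n) \<Rightarrow> (nat \<Rightarrow> real) \<Rightarrow> (nat \<Rightarrow> real) \<Rightarrow> (nat \<Rightarrow> real) \<Rightarrow> bool"
  where
  "frank_wolfe_run f A h x v G D \<alpha> \<longleftrightarrow>
     x 0 \<in> edom h \<and> A (x 0) \<in> edom f \<and>
     (\<forall>k. is_arg_min (\<lambda>x'. ereal (gradient f (A (x k)) \<bullet> A x') + h x') (\<lambda>_. True) (v k) \<and>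
          ereal (G k) = ereal (gradient f (A (x k)) \<bullet> A (x k - v k)) + h (x k) - h (v k) \<and>
          D k = local_norm f (A (x k)) (A (v k - x k)) \<and>
          \<alpha> k = step_size (G k) (D k) \<and>
          x (Suc k) = x k + \<alpha> k *\<^sub>R (v k - x k))"

text \<open>The inverse step is taken in \<^typ>\<open>ereal\<close>, where the inverse of 0 is \<open>\<infinity>\<close> and
  \<open>\<infinity> * 0 = 0\<close>.  A zero step therefore makes the Bregman term the indicator of its zero set,
  so that \<^term>\<open>y k\<close> itself is the minimizer.\<close>

definition mirror_descent_run ::
    "(real^'m) set \<Rightarrow> (real^'m \<Rightarrow> ereal) \<Rightarrow> (real^'n \<Rightarrow> real^'m) \<Rightarrow> (real^'n \<Rightarrow> ereal) \<Rightarrow>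
     (nat \<Rightarrow> real^'m) \<Rightarrow> (nat \<Rightarrow> real^'n) \<Rightarrow> (nat \<Rightarrow> real^'n) \<Rightarrow> (nat \<Rightarrow> real^'m) \<Rightarrow>
     (nat \<Rightarrow> real) \<Rightarrow> (nat \<Rightarrow> real) \<Rightarrow> (nat \<Rightarrow> real) \<Rightarrow> bool"
  where
  "mirror_descent_run K f A h y z s g G D \<gamma> \<longleftrightarrow>
     y 0 \<in> interior (polar_cone K) \<and>
     z 0 \<in> edom h \<and> A (z 0) = gradient (fenchel f) (y 0) \<and>
     (\<forall>k. s k \<in> subdiff (fenchel h) (- adjoint A (y k)) \<and>
          g k = gradient (fenchel f) (y k) - A (s k) \<and>
          z (Suc k) = (1 - \<gamma> k) *\<^sub>R z k + \<gamma> k *\<^sub>R s k \<and>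
          ereal (G k) = ereal (g k \<bullet> y k) + h (z k) - h (s k) \<and>
          D k = local_norm f (gradient (fenchel f) (y k)) (g k) \<and>
          \<gamma> k = step_size (G k) (D k) \<and>
          is_arg_min
            (\<lambda>y'. ereal (g k \<bullet> y') + inverse (ereal (\<gamma> k)) * bregman (fenchel f) y' (y k))
            (\<lambda>_. True) (y (Suc k)))"

end

theory Submission
  imports Defs
begin

text \<open>
  The correspondence is \<open>z = x\<close>, \<open>s = v\<close> and \<open>y = \<nabla>f(A x)\<close>. It rests on the fact that the gradient
  of the barrier is a bijection from the interior of the cone onto the interior of the polar
  cone, with inverse the gradient of \<open>f\<^sup>*\<close>. So \<open>\<nabla>f\<^sup>*(y) = A x\<close> as long as both runs agree.

  Assume that they agree up to some iteration. The subgradients of \<open>h\<^sup>*\<close> at \<open>- A\<^sup>* y\<close> are exactly the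
  minimizers of \<open>\<langle>y, A x\<rangle> + h x\<close>, by the Fenchel-Moreau theorem
  (\<open>subdiff_fenchel_iff_is_arg_min\<close>), so both methods choose from the same set. Then
  \<open>g = A x - A s\<close> is minus the image of the Frank-Wolfe direction, and gaps, norms and step sizes
  coincide. The optimality condition of the mirror step reads
  \<open>\<nabla>f\<^sup>*(y') = A x - \<gamma> g = A x'\<close>, where \<open>x'\<close> is the next Frank-Wolfe iterate. Hence the unique
  minimizer is \<open>y' = \<nabla>f(A x')\<close> (\<open>mirror_step_iff\<close>), provided that \<open>A x'\<close> lies in the interior of
  the cone.

  That proviso is where self-concordance enters. The step size makes the local norm of
  \<open>A (x' - x)\<close> smaller than one (\<open>step_size_bounds\<close>), and the open Dikin ellipsoid, the unit ball of
  the local norm, is contained in the interior of the cone (\<open>Dikin_ellipsoid\<close>). The proof of the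
  latter bounds the second derivative along a ray (\<open>self_concordant_growth\<close>) and uses that \<open>f\<close>
  tends to infinity at the boundary.

  Two further facts settle the starting points. Gradients of \<open>f\<close> lie in the interior of the polar
  cone (\<open>gradient_in_interior_polar\<close>), so that a Frank-Wolfe run gives an admissible \<open>y 0\<close>.
  Conversely every point of that interior is such a gradient (\<open>interior_polar_imp_gradient\<close>), so
  that \<open>A (z 0) = \<nabla>f\<^sup>*(y 0)\<close> lies in the domain of \<open>f\<close>. The formula \<open>\<nabla>f\<^sup>*(\<nabla>f(u)) = u\<close>, including
  the differentiability of \<open>f\<^sup>*\<close>, comes from invariance of domain
  (\<open>gradient_fenchel_gradient\<close>).
\<close>

section \<open>Gradients\<close>

lemma gradient_eqI:
  assumes "GDERIV (\<lambda>v. real_of_ereal (w v)) u :> a"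
  shows "gradient w u = a"
  unfolding gradient_def
proof (rule the_equality)
  fix b assume "GDERIV (\<lambda>v. real_of_ereal (w v)) u :> b"
  then have "(\<lambda>p. p \<bullet> b) = (\<lambda>p. p \<bullet> a)"
    using assms has_derivative_unique unfolding gderiv_def by blast
  then have "\<And>p. p \<bullet> b = p \<bullet> a" by meson
  then show "b = a" by (metis inner_commute vector_eq_rdot)
qed (rule assms)

lemma GDERIV_gradient:
  fixes w :: "'a::euclidean_space \<Rightarrow> ereal"
  assumes "(\<lambda>v. real_of_ereal (w v)) differentiable (at u)"
  shows "GDERIV (\<lambda>v. real_of_ereal (w v)) u :> gradient w u"
proof -
  obtain L where L: "((\<lambda>v. real_of_ereal (w v)) has_derivative L) (at u)"
    using assms unfolding differentiable_def by blast
  then have "linear L" by (rule has_derivative_linear)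
  then have "\<exists>a. L = (\<lambda>p. p \<bullet> a)"
    by (intro exI[of _ "adjoint L 1"]) (simp add: adjoint_works fun_eq_iff)
  then obtain a where "L = (\<lambda>p. p \<bullet> a)" ..
  then have "GDERIV (\<lambda>v. real_of_ereal (w v)) u :> a"
    using L by (simp add: gderiv_def)
  then show ?thesis by (simp add: gradient_eqI)
qed

lemma GDERIV_along_line:
  fixes F :: "'a::real_inner \<Rightarrow> real"
  assumes "GDERIV F (u + t *\<^sub>R w) :> a"
  shows "((\<lambda>t. F (u + t *\<^sub>R w)) has_real_derivative a \<bullet> w) (at t)"
proof -
  have "((\<lambda>t. u + t *\<^sub>R w) has_derivative (\<lambda>h. h *\<^sub>R w)) (at t)"
    by (auto intro!: derivative_eq_intros)
  moreover have "(F has_derivative (\<lambda>p. p \<bullet> a)) (at (u + t *\<^sub>R w))"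
    using assms by (simp add: gderiv_def)
  ultimately have "((\<lambda>t. F (u + t *\<^sub>R w)) has_derivative (\<lambda>h. (h *\<^sub>R w) \<bullet> a)) (at t)"
    by (rule has_derivative_compose)
  moreover have "(\<lambda>h. (h *\<^sub>R w) \<bullet> a) = (*) (a \<bullet> w)"
    by (simp add: fun_eq_iff inner_commute)
  ultimately show ?thesis
    unfolding has_field_derivative_def by simp
qed

text \<open>Along the segment from \<open>u\<close> to \<open>v\<close> the function lies below its chord, so its slope at \<open>u\<close>
  cannot exceed that of the chord. Strictness is recovered by comparing with the midpoint.\<close>

lemma strict_gradient_inequality:
  fixes F :: "'a::real_inner \<Rightarrow> real"
  assumes "convex S" "u \<in> S" "v \<in> S" "u \<noteq> v"
    and strict: "\<And>a b t. \<lbrakk>a \<in> S; b \<in> S; a \<noteq> b; 0 < t; t < 1\<rbrakk>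
      \<Longrightarrow> F ((1 - t) *\<^sub>R a + t *\<^sub>R b) < (1 - t) * F a + t * F b"
    and grad: "GDERIV F u :> a"
  shows "F u + a \<bullet> (v - u) < F v"
proof -
  have segment: "u + t *\<^sub>R (w - u) = (1 - t) *\<^sub>R u + t *\<^sub>R w" for t w
    by (simp add: scaleR_diff_right scaleR_diff_left)
  have weak: "a \<bullet> (w - u) \<le> F w - F u" if w: "w \<in> S" "u \<noteq> w" for w
  proof (rule ccontr)
    assume neg: "\<not> ?thesis"
    define q where "q = (\<lambda>t. F (u + t *\<^sub>R (w - u)) - t * (F w - F u))"
    have "(q has_real_derivative a \<bullet> (w - u) - (F w - F u)) (at 0)"
      unfolding q_def using grad
      by (intro DERIV_diff GDERIV_along_line) (auto intro!: derivative_eq_intros)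
    then obtain d where d: "0 < d" "\<And>h. 0 < h \<Longrightarrow> h < d \<Longrightarrow> q 0 < q (0 + h)"
      using DERIV_pos_inc_right[of q "a \<bullet> (w - u) - (F w - F u)" 0] neg by auto
    define h where "h = min (d / 2) (1 / 2)"
    have h: "0 < h" "h < d" "h < 1" using d(1) by (auto simp: h_def)
    have "F u < q h" using d(2)[OF h(1,2)] by (simp add: q_def)
    then show False
      using strict[OF \<open>u \<in> S\<close> w h(1,3)] by (simp add: q_def segment algebra_simps)
  qed
  define m where "m = u + (1/2) *\<^sub>R (v - u)"
  have m: "m = (1 - 1/2) *\<^sub>R u + (1/2) *\<^sub>R v"
    unfolding m_def by (rule segment)
  have "m \<in> S" using assms(1-3) unfolding m by (intro convexD_alt) auto
  moreover have "u \<noteq> m" using \<open>u \<noteq> v\<close> by (simp add: m_def)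
  moreover have "m - u = (1/2) *\<^sub>R (v - u)" by (simp add: m_def)
  ultimately have "(a \<bullet> (v - u)) / 2 \<le> F m - F u" using weak[of m] by simp
  moreover have "F m < F u / 2 + F v / 2"
    using strict[of u v "1/2"] assms by (simp add: m)
  ultimately show ?thesis by simp
qed

section \<open>Self-concordance on a line\<close>

text \<open>Self-concordance says that \<open>\<psi> powr (-1/2)\<close> is 1-Lipschitz wherever \<open>\<psi>\<close> is positive. Adding
  a positive constant to \<open>\<psi>\<close> keeps the Lipschitz property and removes the singularity at zeros of
  \<open>\<psi>\<close>. The constant is chosen so that the initial value becomes \<open>c\<^sup>2\<close>, and the bound is the
  solution of the extremal equation \<open>\<psi>' = 2 * \<psi> powr (3/2)\<close> with that initial value.\<close>

lemma self_concordant_growth: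
  fixes \<psi> \<psi>' :: "real \<Rightarrow> real"
  assumes deriv: "\<And>t. \<lbrakk>0 \<le> t; t < b\<rbrakk> \<Longrightarrow> (\<psi> has_real_derivative \<psi>' t) (at t)"
    and nonneg: "\<And>t. \<lbrakk>0 \<le> t; t < b\<rbrakk> \<Longrightarrow> 0 \<le> \<psi> t"
    and sc: "\<And>t. \<lbrakk>0 \<le> t; t < b\<rbrakk> \<Longrightarrow> \<bar>\<psi>' t\<bar> \<le> 2 * \<psi> t powr (3/2)"
    and c: "0 < c" "\<psi> 0 < c\<^sup>2"
    and t: "0 \<le> t" "t < b" "t * c < 1"
  shows "\<psi> t \<le> (c / (1 - t * c))\<^sup>2"
proof -
  define e where "e = c\<^sup>2 - \<psi> 0"
  have e: "0 < e" using c by (simp add: e_def)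
  define \<phi> where "\<phi> = (\<lambda>t. (\<psi> t + e) powr (-1/2))"
  have pos: "0 < \<psi> r + e" if "0 \<le> r" "r < b" for r using nonneg[OF that] e by simp
  have \<phi>_deriv: "(\<phi> has_real_derivative (-1/2) * (\<psi> r + e) powr (-3/2) * \<psi>' r) (at r)"
    if "0 \<le> r" "r < b" for r
    unfolding \<phi>_def
    by (rule derivative_eq_intros deriv that pos refl | simp add: pos that)+
  have \<phi>_lipschitz: "- 1 \<le> (-1/2) * (\<psi> r + e) powr (-3/2) * \<psi>' r" if r: "0 \<le> r" "r < b" for r
  proof -
    have "(\<psi> r + e) powr (-3/2) * \<psi>' r \<le> (\<psi> r + e) powr (-3/2) * (2 * \<psi> r powr (3/2))"
      using sc[OF r] by (intro mult_left_mono) auto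
    also have "\<dots> \<le> (\<psi> r + e) powr (-3/2) * (2 * (\<psi> r + e) powr (3/2))"
      using nonneg[OF r] e by (intro mult_left_mono powr_mono2) auto
    also have "\<dots> = 2"
      using pos[OF r] by (simp flip: powr_add)
    finally show ?thesis by simp
  qed
  have "\<phi> 0 - t \<le> \<phi> t"
  proof (cases "t = 0")
    case False
    then have "0 < t" using t by simp
    then obtain r where r: "0 < r" "r < t"
      "\<phi> t - \<phi> 0 = (t - 0) * ((-1/2) * (\<psi> r + e) powr (-3/2) * \<psi>' r)"
      using MVT2[of 0 t \<phi> "\<lambda>r. (-1/2) * (\<psi> r + e) powr (-3/2) * \<psi>' r"] \<phi>_deriv t(2) by force
    have "t * (- 1) \<le> t * ((-1/2) * (\<psi> r + e) powr (-3/2) * \<psi>' r)"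
      using r t \<phi>_lipschitz[of r] by (intro mult_left_mono) auto
    then show ?thesis using r(3) by simp
  qed simp
  moreover have "\<phi> 0 = 1 / c"
  proof -
    have "\<phi> 0 = (c\<^sup>2) powr (-1/2)" by (simp add: \<phi>_def e_def)
    also have "\<dots> = (c powr 2) powr (-1/2)" using c by simp
    also have "\<dots> = 1 / c" using c by (simp add: powr_powr powr_minus_divide)
    finally show ?thesis .
  qed
  ultimately have lower: "(1 - t * c) / c \<le> \<phi> t" using c by (simp add: field_simps)
  have "\<psi> t + e = (1 / \<phi> t)\<^sup>2"
  proof -
    have "(1 / \<phi> t)\<^sup>2 = ((\<psi> t + e) powr (1/2))\<^sup>2"
      by (simp add: \<phi>_def powr_minus_divide)
    also have "\<dots> = \<psi> t + e" using pos[OF t(1,2)] by (simp add: powr_half_sqrt)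
    finally show ?thesis by simp
  qed
  also have "\<dots> \<le> (c / (1 - t * c))\<^sup>2"
  proof (rule power_mono)
    have p: "0 < (1 - t * c) / c" using c t by simp
    have "1 / \<phi> t \<le> 1 / ((1 - t * c) / c)"
      using lower p by (intro divide_left_mono mult_pos_pos) linarith+
    then show "1 / \<phi> t \<le> c / (1 - t * c)" by simp
    show "0 \<le> 1 / \<phi> t" using lower p by simp
  qed
  finally show ?thesis using e by simp
qed

section \<open>Subgradients of the conjugate\<close>

lemma fenchel_ge: "ereal (p \<bullet> u) - w u \<le> fenchel w p"
  unfolding fenchel_def by (rule SUP_upper) simp

text \<open>This is the Fenchel-Moreau inequality in the form needed here. If \<open>(s, s \<bullet> p - h\<^sup>* p)\<close>
  lay outside the epigraph of \<open>h\<close>, a separating hyperplane with normal \<open>(a, b)\<close> would violate the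
  subgradient inequality, at \<open>- a / b\<close> if the hyperplane is not vertical and at \<open>p - a\<close> if it is.\<close>

lemma subdiff_fenchel_imp:
  fixes h :: "'a::euclidean_space \<Rightarrow> ereal"
  assumes "proper h" "closed_fun h" "convex_fun h"
    and s: "s \<in> subdiff (fenchel h) p"
  shows "h s + fenchel h p \<le> ereal (p \<bullet> s)"
proof -
  obtain c where c: "fenchel h p = ereal c"
    using s by (cases "fenchel h p") (auto simp: subdiff_def)
  have sub: "ereal (c + s \<bullet> (v - p)) \<le> fenchel h v" for v
    using s c by (auto simp: subdiff_def)
  define r where "r = p \<bullet> s - c"
  have "(s, r) \<in> epi h"
  proof (rule ccontr)
    assume "(s, r) \<notin> epi h"
    then obtain N e where Ne: "N \<bullet> (s, r) < e" "\<forall>x\<in>epi h. e < N \<bullet> x"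
      using separating_hyperplane_closed_point[of "epi h" "(s, r)"] assms
      unfolding closed_fun_def convex_fun_def by blast
    obtain a b where N: "N = (a, b)" by (cases N)
    have sep1: "a \<bullet> s + b * r < e" using Ne N by simp
    have sep2: "e < a \<bullet> x + b * t" if "h x \<le> ereal t" for x t
      using Ne(2)[rule_format, of "(x, t)"] that N by (simp add: epi_def)
    obtain x0 where "h x0 < \<infinity>" "h x0 \<noteq> - \<infinity>"
      using \<open>proper h\<close> unfolding proper_def edom_def by auto
    then obtain t0 where x0: "h x0 = ereal t0"
      by (cases "h x0") auto
    have b: "0 \<le> b"
    proof (rule ccontr)
      assume "\<not> 0 \<le> b"
      then have "b < 0" by simp
      define t where "t = max t0 ((e - a \<bullet> x0) / b)"
      have "h x0 \<le> ereal t" using x0 by (simp add: t_def)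
      then have "e < a \<bullet> x0 + b * t" by (rule sep2)
      moreover have "b * t \<le> b * ((e - a \<bullet> x0) / b)"
        using \<open>b < 0\<close> by (intro mult_left_mono_neg) (auto simp: t_def)
      ultimately show False using \<open>b < 0\<close> by simp
    qed
    show False
    proof (cases "b = 0")
      case False
      then have "0 < b" using b by simp
      have "fenchel h (- (1 / b) *\<^sub>R a) \<le> ereal (- e / b)"
        unfolding fenchel_def
      proof (rule SUP_least)
        fix u
        show "ereal (- (1 / b) *\<^sub>R a \<bullet> u) - h u \<le> ereal (- e / b)"
        proof (cases "h u")
          case (real t)
          then have "e < a \<bullet> u + b * t" using sep2 by simp
          then have "e / b \<le> (a \<bullet> u + b * t) / b" using \<open>0 < b\<close> by (intro divide_right_mono) auto
          then have "- (a \<bullet> u) / b - t \<le> - e / b" using \<open>0 < b\<close> by (simp add: add_divide_distrib)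
          then show ?thesis using real by simp
        qed (use \<open>proper h\<close> in \<open>auto simp: proper_def\<close>)
      qed
      then have "c + s \<bullet> (- (1 / b) *\<^sub>R a - p) \<le> - e / b"
        using sub order_trans by (metis ereal_less_eq(3))
      then have "b * (c + s \<bullet> (- (1 / b) *\<^sub>R a - p)) \<le> b * (- e / b)"
        using \<open>0 < b\<close> by (intro mult_left_mono) auto
      then show False using sep1 \<open>0 < b\<close>
        by (simp add: r_def inner_diff_right inner_commute algebra_simps)
    next
      case True
      have "fenchel h (p - a) \<le> ereal (c - e)"
        unfolding fenchel_def
      proof (rule SUP_least)
        fix u
        show "ereal ((p - a) \<bullet> u) - h u \<le> ereal (c - e)"
        proof (cases "h u")
          case (real t)
          then have "e < a \<bullet> u" using sep2[of u t] True by simp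
          moreover have "p \<bullet> u - t \<le> c" using fenchel_ge[of p u h] c real by simp
          ultimately show ?thesis using real by (simp add: inner_diff_left)
        qed (use \<open>proper h\<close> in \<open>auto simp: proper_def\<close>)
      qed
      then have "c + s \<bullet> (p - a - p) \<le> c - e"
        using sub order_trans by (metis ereal_less_eq(3))
      then show False using sep1 True by (simp add: inner_commute)
    qed
  qed
  then have "h s \<le> ereal r" by (simp add: epi_def)
  then show ?thesis using c by (cases "h s") (auto simp: r_def)
qed

lemma subdiff_fenchel_iff_is_arg_min:
  fixes h :: "'a::euclidean_space \<Rightarrow> ereal"
  assumes "proper h" "closed_fun h" "convex_fun h"
  shows "s \<in> subdiff (fenchel h) p \<longleftrightarrow> is_arg_min (\<lambda>x. ereal (- p \<bullet> x) + h x) (\<lambda>_. True) s"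
proof
  assume s: "s \<in> subdiff (fenchel h) p"
  obtain c where c: "fenchel h p = ereal c"
    using s by (cases "fenchel h p") (auto simp: subdiff_def)
  have le: "h s + ereal c \<le> ereal (p \<bullet> s)" using subdiff_fenchel_imp[OF assms s] c by simp
  have "ereal (- p \<bullet> s) + h s \<le> ereal (- p \<bullet> x) + h x" for x
  proof -
    have 1: "ereal (p \<bullet> x) - h x \<le> ereal c" using fenchel_ge[of p x h] c by simp
    show ?thesis using le 1 \<open>proper h\<close>
      by (cases "h s"; cases "h x") (auto simp: proper_def)
  qed
  then show "is_arg_min (\<lambda>x. ereal (- p \<bullet> x) + h x) (\<lambda>_. True) s"
    by (auto simp: is_arg_min_def not_less)
next
  assume s: "is_arg_min (\<lambda>x. ereal (- p \<bullet> x) + h x) (\<lambda>_. True) s"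
  then have min: "ereal (- p \<bullet> s) + h s \<le> ereal (- p \<bullet> x) + h x" for x
    by (auto simp: is_arg_min_def not_less)
  obtain x0 where "h x0 < \<infinity>"
    using \<open>proper h\<close> unfolding proper_def edom_def by auto
  then have "ereal (- p \<bullet> s) + h s < \<infinity>" using min[of x0]
    by (cases "h x0") auto
  then obtain r where r: "h s = ereal r"
    using \<open>proper h\<close> by (cases "h s") (auto simp: proper_def)
  have "fenchel h p = ereal (p \<bullet> s - r)"
  proof (rule antisym)
    show "fenchel h p \<le> ereal (p \<bullet> s - r)"
      unfolding fenchel_def
    proof (rule SUP_least)
      fix x show "ereal (p \<bullet> x) - h x \<le> ereal (p \<bullet> s - r)"
        using min[of x] r by (cases "h x") auto
    qed
    show "ereal (p \<bullet> s - r) \<le> fenchel h p" using fenchel_ge[of p s h] r by simp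
  qed
  moreover have "ereal (v \<bullet> s - r) \<le> fenchel h v" for v using fenchel_ge[of v s h] r by simp
  ultimately show "s \<in> subdiff (fenchel h) p"
    by (auto simp: subdiff_def inner_diff_right inner_commute)
qed

section \<open>The step size\<close>

text \<open>If \<open>D > 0\<close>, the step \<open>\<alpha>\<close> satisfies \<open>\<alpha> * D \<le> G / (G + D) < 1\<close>. The last bound says that the
  displacement has local norm less than one, so that the step stays in the open Dikin ellipsoid.\<close>

lemma step_size_bounds:
  assumes "0 \<le> G" "0 \<le> D"
  shows "0 \<le> step_size G D" "step_size G D \<le> 1" "step_size G D * D < 1"
proof -
  have "0 \<le> step_size G D \<and> step_size G D \<le> 1 \<and> step_size G D * D < 1"
  proof (cases "D = 0")
    case True
    then show ?thesis
      using assms step_size_zero_gap[of 0] step_size_zero_norm[of G] by (cases "G = 0") auto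
  next
    case False
    then have D: "0 < D" using assms by simp
    have "step_size G D * D \<le> G / (D * (G + D)) * D"
      using D step_size_regular[OF assms(1) D] by (intro mult_right_mono) auto
    also have "\<dots> = G / (G + D)" using D by simp
    also have "\<dots> < 1" using D assms by simp
    finally show ?thesis using step_size_regular[OF assms(1) D] D assms by simp
  qed
  then show "0 \<le> step_size G D" "step_size G D \<le> 1" "step_size G D * D < 1" by auto
qed

section \<open>Barriers on a regular cone\<close>

locale regular_cone_barrier =
  fixes K :: "(real^'m) set" and \<theta> :: real and f :: "real^'m \<Rightarrow> ereal"
  assumes cone: "regular_cone K" and theta: "1 \<le> \<theta>" and barrier: "lh_sc_barrier \<theta> K f"
begin

abbreviation F :: "real^'m \<Rightarrow> real" where "F u \<equiv> real_of_ereal (f u)"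

lemma edom_f: "edom f = interior K"
  using barrier by (simp add: lh_sc_barrier_def)

lemma f_interior: "u \<in> interior K \<Longrightarrow> f u = ereal (F u)"
  using barrier by (cases "f u") (auto simp: lh_sc_barrier_def edom_def)

lemma f_exterior: "u \<notin> interior K \<Longrightarrow> f u = \<infinity>"
  using edom_f by (auto simp: edom_def)

lemma convex_interior_K: "convex (interior K)"
  using cone by (simp add: regular_cone_def convex_interior)

lemma GDERIV_F: "u \<in> interior K \<Longrightarrow> GDERIV F u :> gradient f u"
  using barrier by (intro GDERIV_gradient)
    (simp add: lh_sc_barrier_def three_times_differentiable_on_def)

lemma isCont_F: "u \<in> interior K \<Longrightarrow> isCont F u"
  using GDERIV_F has_derivative_continuous unfolding gderiv_def by blast

lemma F_gradient_less:
  assumes "u \<in> interior K" "v \<in> interior K" "u \<noteq> v"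
  shows "F u + gradient f u \<bullet> (v - u) < F v"
proof (rule strict_gradient_inequality[OF convex_interior_K assms _ GDERIV_F[OF assms(1)]])
  fix a b :: "real^'m" and t :: real
  assume ab: "a \<in> interior K" "b \<in> interior K" "a \<noteq> b" "0 < t" "t < 1"
  then have "(1 - t) *\<^sub>R a + t *\<^sub>R b \<in> interior K"
    using convex_interior_K by (intro convexD_alt) auto
  moreover have "f ((1 - t) *\<^sub>R a + t *\<^sub>R b) < ereal (1 - t) * f a + ereal t * f b"
    using barrier ab by (auto simp: lh_sc_barrier_def strictly_convex_on_def)
  ultimately have "ereal (F ((1 - t) *\<^sub>R a + t *\<^sub>R b)) < ereal ((1 - t) * F a + t * F b)"
    using f_interior ab by (metis plus_ereal.simps(1) times_ereal.simps(1))
  then show "F ((1 - t) *\<^sub>R a + t *\<^sub>R b) < (1 - t) * F a + t * F b" by simp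
qed

lemma F_gradient_le:
  assumes "u \<in> interior K" "v \<in> interior K"
  shows "F u + gradient f u \<bullet> (v - u) \<le> F v"
  using F_gradient_less[OF assms] by (cases "u = v") auto

lemma gradient_strict_mono:
  assumes "u \<in> interior K" "v \<in> interior K" "u \<noteq> v"
  shows "gradient f u \<bullet> (v - u) < gradient f v \<bullet> (v - u)"
  using F_gradient_less[OF assms] F_gradient_less[OF assms(2,1)] assms(3)
  by (simp add: inner_diff_right)

lemma scale_interior:
  assumes "u \<in> interior K" "0 < t"
  shows "t *\<^sub>R u \<in> interior K" "F (t *\<^sub>R u) = F u - \<theta> * ln t"
proof -
  have "f (t *\<^sub>R u) = ereal (F u - \<theta> * ln t)"
    using barrier assms f_interior[OF assms(1)] unfolding lh_sc_barrier_def
    by (metis ereal_minus(1))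
  then show "F (t *\<^sub>R u) = F u - \<theta> * ln t" "t *\<^sub>R u \<in> interior K"
    using f_exterior by fastforce+
qed

lemma add_interior:
  assumes "u \<in> interior K" "w \<in> K"
  shows "u + w \<in> interior K"
proof (rule interiorI)
  show "open ((\<lambda>x. w + x) ` interior K)" by (rule open_translation) simp
  show "u + w \<in> (\<lambda>x. w + x) ` interior K" using assms by (simp add: add.commute)
  have "w + x \<in> K" if "x \<in> K" for x
  proof -
    have "(1/2) *\<^sub>R w + (1/2) *\<^sub>R x \<in> K"
      using cone that assms(2) unfolding regular_cone_def by (auto intro: convexD)
    then have "2 *\<^sub>R ((1/2) *\<^sub>R w + (1/2) *\<^sub>R x) \<in> K"
      using cone unfolding regular_cone_def Convex.cone_def by (metis zero_le_numeral)
    then show ?thesis by (simp add: scaleR_add_right)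
  qed
  then show "(\<lambda>x. w + x) ` interior K \<subseteq> K" using interior_subset by blast
qed

section \<open>The Dikin ellipsoid\<close>

lemma gradient_has_derivative_hessian:
  assumes "u \<in> interior K"
  shows "(gradient f has_derivative (\<lambda>p. hessian f u *v p)) (at u)"
  unfolding hessian_def jacobian_works[symmetric]
  using barrier assms by (simp add: lh_sc_barrier_def three_times_differentiable_on_def)

lemma slope_has_derivative:
  assumes "u + t *\<^sub>R w \<in> interior K"
  shows "((\<lambda>t. gradient f (u + t *\<^sub>R w) \<bullet> w) has_real_derivative
    w \<bullet> (hessian f (u + t *\<^sub>R w) *v w)) (at t)"
proof -
  have "((\<lambda>t. u + t *\<^sub>R w) has_derivative (\<lambda>h. h *\<^sub>R w)) (at t)"
    by (auto intro!: derivative_eq_intros)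
  from has_derivative_compose[OF this gradient_has_derivative_hessian[OF assms]]
  have "((\<lambda>t. gradient f (u + t *\<^sub>R w) \<bullet> w) has_derivative
      (\<lambda>h. (hessian f (u + t *\<^sub>R w) *v (h *\<^sub>R w)) \<bullet> w)) (at t)"
    by (rule has_derivative_inner_left)
  moreover have "(\<lambda>h. (hessian f (u + t *\<^sub>R w) *v (h *\<^sub>R w)) \<bullet> w) =
      (*) (w \<bullet> (hessian f (u + t *\<^sub>R w) *v w))"
    by (simp add: fun_eq_iff matrix_vector_mult_scaleR inner_commute)
  ultimately show ?thesis unfolding has_field_derivative_def by simp
qed

lemma curvature_has_derivative:
  assumes "u + t *\<^sub>R w \<in> interior K"
  shows "((\<lambda>t. w \<bullet> (hessian f (u + t *\<^sub>R w) *v w)) has_real_derivative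
    third_deriv_diag f (u + t *\<^sub>R w) w) (at t)"
proof -
  let ?p = "u + t *\<^sub>R w"
  define L where "L = frechet_derivative (hessian f) (at ?p)"
  have "(hessian f has_derivative L) (at ?p)"
    unfolding L_def frechet_derivative_works[symmetric]
    using barrier assms by (simp add: lh_sc_barrier_def three_times_differentiable_on_def)
  moreover have "((\<lambda>t. u + t *\<^sub>R w) has_derivative (\<lambda>h. h *\<^sub>R w)) (at t)"
    by (auto intro!: derivative_eq_intros)
  ultimately have 1: "((\<lambda>t. hessian f (u + t *\<^sub>R w)) has_derivative (\<lambda>h. L (h *\<^sub>R w))) (at t)"
    using has_derivative_compose by blast
  have "linear (\<lambda>M :: real^'m^'m. w \<bullet> (M *v w))"
    by (rule linearI)
      (simp_all add: matrix_vector_mult_add_rdistrib inner_add_right flip: scaleR_matrix_vector_assoc)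
  then have "bounded_linear (\<lambda>M :: real^'m^'m. w \<bullet> (M *v w))"
    by (simp add: linear_conv_bounded_linear)
  from bounded_linear.has_derivative[OF this 1]
  have "((\<lambda>t. w \<bullet> (hessian f (u + t *\<^sub>R w) *v w)) has_derivative
      (\<lambda>h. w \<bullet> (L (h *\<^sub>R w) *v w))) (at t)" .
  moreover have "linear L"
    using \<open>(hessian f has_derivative L) (at ?p)\<close> by (rule has_derivative_linear)
  then have "(\<lambda>h. w \<bullet> (L (h *\<^sub>R w) *v w)) = (*) (third_deriv_diag f ?p w)"
    by (simp add: fun_eq_iff linear_cmul third_deriv_diag_def L_def inner_commute
        flip: scaleR_matrix_vector_assoc)
  ultimately show ?thesis unfolding has_field_derivative_def by simp
qed

lemma curvature_nonneg:
  assumes "u \<in> interior K"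
  shows "0 \<le> w \<bullet> (hessian f u *v w)"
proof (rule ccontr)
  assume "\<not> ?thesis"
  then have neg: "w \<bullet> (hessian f u *v w) < 0" and "w \<noteq> 0" by auto
  obtain d where d: "0 < d" "\<And>h. 0 < h \<Longrightarrow> h < d \<Longrightarrow> gradient f (u + h *\<^sub>R w) \<bullet> w < gradient f u \<bullet> w"
    using DERIV_neg_dec_right[OF slope_has_derivative[of u 0 w]] neg assms by auto
  obtain e where e: "0 < e" "ball u e \<subseteq> interior K"
    using assms open_interior open_contains_ball by blast
  define h where "h = min (d / 2) (e / (2 * norm w))"
  have h: "0 < h" "h < d" "h * norm w < e"
  proof -
    show "0 < h" "h < d" using d e \<open>w \<noteq> 0\<close> by (auto simp: h_def)
    have "h * norm w \<le> e / (2 * norm w) * norm w" by (intro mult_right_mono) (auto simp: h_def)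
    also have "\<dots> < e" using \<open>w \<noteq> 0\<close> e by simp
    finally show "h * norm w < e" .
  qed
  then have "u + h *\<^sub>R w \<in> interior K" using e(2) by (auto simp: dist_norm subset_eq)
  then have "gradient f u \<bullet> (h *\<^sub>R w) < gradient f (u + h *\<^sub>R w) \<bullet> (h *\<^sub>R w)"
    using gradient_strict_mono[OF assms, of "u + h *\<^sub>R w"] h(1) \<open>w \<noteq> 0\<close> by simp
  then show False using d(2)[OF h(1,2)] h(1) by simp
qed

text \<open>On the ray from \<open>u\<close> in direction \<open>w\<close> self-concordance keeps the second derivative of \<open>f\<close>
  bounded up to the parameter \<open>1 / local_norm f u w\<close>, so \<open>f\<close> itself stays bounded there. As \<open>f\<close>
  tends to infinity at the boundary, the ray cannot meet the boundary before that parameter.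
  Directions of vanishing local norm are included, so that a full step taken because \<open>D = 0\<close> is
  harmless as well.\<close>

lemma Dikin_ellipsoid:
  assumes u: "u \<in> interior K" and w: "local_norm f u w < 1"
  shows "u + w \<in> interior K"
proof (rule ccontr)
  assume out: "u + w \<notin> interior K"
  define line where "line = (\<lambda>t::real. u + t *\<^sub>R w)"
  define T where "T = {0..1} \<inter> line -` (- interior K)"
  have cont: "continuous_on UNIV line" unfolding line_def by (intro continuous_intros)
  have "closed (line -` (- interior K))"
    using cont by (intro closed_vimage) auto
  then have "compact T" unfolding T_def by (intro compact_Int_closed) auto
  moreover have "1 \<in> T" using out by (simp add: T_def line_def)
  ultimately obtain b where b: "b \<in> T" "\<And>t. t \<in> T \<Longrightarrow> b \<le> t"
    using compact_attains_inf[of T] by blast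
  have b01: "0 \<le> b" "b \<le> 1" and b_out: "line b \<notin> interior K" using b(1) by (auto simp: T_def)
  have inside: "line t \<in> interior K" if "0 \<le> t" "t < b" for t
    using b(2)[of t] that b01 by (force simp: T_def)
  have "b \<noteq> 0" using b_out u by (auto simp: line_def)
  then have b_pos: "0 < b" using b01 by simp
  define D where "D = local_norm f u w"
  have quad: "w \<bullet> (hessian f u *v w) = D\<^sup>2" "0 \<le> D"
    using curvature_nonneg[OF u, of w] by (simp_all add: D_def local_norm_def)
  \<comment> \<open>Any number strictly between the local norm and one would do.\<close>
  define c where "c = (D + 1) / 2"
  have c: "0 < c" "D < c" "c < 1" using quad(2) w by (auto simp: c_def D_def)
  define \<psi> where "\<psi> = (\<lambda>t. w \<bullet> (hessian f (line t) *v w))"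
  have \<psi>0: "\<psi> 0 < c\<^sup>2" using quad c by (simp add: \<psi>_def line_def power_strict_mono)
  define M where "M = (c / (1 - c))\<^sup>2"
  have \<psi>_le: "\<psi> t \<le> M" if t: "0 \<le> t" "t < b" for t
  proof -
    have tc: "t * c \<le> c" using t b01 c by (simp add: mult_le_cancel_right1)
    then have tc': "t * c < 1" using c by linarith
    have "\<psi> t \<le> (c / (1 - t * c))\<^sup>2"
    proof (rule self_concordant_growth[where b = b and \<psi>' = "\<lambda>t. third_deriv_diag f (line t) w"])
      fix t assume t: "0 \<le> t" "t < b"
      show "(\<psi> has_real_derivative third_deriv_diag f (line t) w) (at t)"
        using curvature_has_derivative[of u t w] inside[OF t] by (simp add: \<psi>_def line_def)
      show "0 \<le> \<psi> t" using curvature_nonneg inside[OF t] by (simp add: \<psi>_def)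
      show "\<bar>third_deriv_diag f (line t) w\<bar> \<le> 2 * \<psi> t powr (3/2)"
        using barrier inside[OF t] by (simp add: lh_sc_barrier_def \<psi>_def inner_commute)
    qed (use \<psi>0 c(1) t tc' in auto)
    also have "\<dots> \<le> M" unfolding M_def
      using tc tc' c by (intro power_mono divide_left_mono mult_pos_pos divide_nonneg_pos) linarith+
    finally show ?thesis .
  qed
  have M: "0 \<le> M" by (simp add: M_def)
  define g where "g = (\<lambda>t. gradient f (line t) \<bullet> w)"
  have g_le: "g t \<le> g 0 + M" if t: "0 \<le> t" "t < b" for t
  proof (cases "t = 0")
    case False
    then have "0 < t" using t by simp
    moreover have "(g has_real_derivative \<psi> r) (at r)" if "0 \<le> r" "r \<le> t" for r
      using slope_has_derivative[of u r w] inside[of r] t that by (simp add: \<psi>_def line_def g_def)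
    ultimately obtain r where r: "0 < r" "r < t" "g t - g 0 = (t - 0) * \<psi> r"
      using MVT2[of 0 t g \<psi>] by blast
    have "t * \<psi> r \<le> t * M" using \<psi>_le[of r] r t by (intro mult_left_mono) auto
    also have "\<dots> \<le> 1 * M" using t b01 M by (intro mult_right_mono) auto
    finally show ?thesis using r(3) by simp
  qed (simp add: M)
  define B where "B = F u + \<bar>g 0 + M\<bar>"
  have F_le: "F (line t) \<le> B" if t: "0 \<le> t" "t < b" for t
  proof (cases "t = 0")
    case False
    then have "0 < t" using t by simp
    moreover have "((\<lambda>t. F (line t)) has_real_derivative g r) (at r)" if "0 \<le> r" "r \<le> t" for r
      using GDERIV_along_line[OF GDERIV_F, of u r w] inside[of r] t that by (simp add: line_def g_def)
    ultimately obtain r where r: "0 < r" "r < t" "F (line t) - F (line 0) = (t - 0) * g r"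
      using MVT2[of 0 t "\<lambda>t. F (line t)" g] by blast
    have "t * g r \<le> t * \<bar>g 0 + M\<bar>" using g_le[of r] r t by (intro mult_left_mono) auto
    also have "\<dots> \<le> 1 * \<bar>g 0 + M\<bar>" using t b01 by (intro mult_right_mono) auto
    finally show ?thesis using r(3) by (simp add: B_def line_def)
  qed (simp add: B_def line_def)
  \<comment> \<open>Approaching the exit point from inside contradicts the bound on \<open>f\<close>.\<close>
  define s where "s = (\<lambda>k::nat. line (b * (1 - inverse (real (Suc k)))))"
  have s_param: "0 \<le> b * (1 - inverse (real (Suc k)))" "b * (1 - inverse (real (Suc k))) < b" for k
    using b_pos by (auto simp: field_simps)
  have s_in: "s k \<in> interior K" for k unfolding s_def by (rule inside[OF s_param])
  have "(\<lambda>k. b * (1 - inverse (real (Suc k)))) \<longlonglongrightarrow> b * (1 - 0)"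
    by (intro tendsto_intros LIMSEQ_inverse_real_of_nat)
  then have s_lim: "s \<longlonglongrightarrow> line b"
    using cont unfolding s_def by (auto intro!: continuous_on_tendsto_compose[of UNIV line])
  have "line b \<in> closure (interior K)" using s_in s_lim closure_sequential by blast
  then have "line b \<in> frontier K"
    using b_out closure_mono[OF interior_subset] unfolding frontier_def by blast
  then have "(\<lambda>k. f (s k)) \<longlonglongrightarrow> \<infinity>"
    using barrier s_in s_lim unfolding lh_sc_barrier_def by blast
  then have "\<forall>\<^sub>F k in sequentially. ereal B < f (s k)"
    by (rule order_tendstoD) simp
  then obtain k where "ereal B < f (s k)" by (auto simp: eventually_sequentially)
  moreover have "f (s k) \<le> ereal B"
    using f_interior[OF s_in] F_le[OF s_param] unfolding s_def by (metis ereal_less_eq(3))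
  ultimately show False by simp
qed

section \<open>The gradient map and the conjugate barrier\<close>

lemma fenchel_f_ge: "u \<in> interior K \<Longrightarrow> ereal (y \<bullet> u - F u) \<le> fenchel f y"
  using fenchel_ge[of y u f] f_interior[of u] by (cases "f u") auto

lemma fenchel_f_gradient:
  assumes u: "u \<in> interior K"
  shows "fenchel f (gradient f u) = ereal (gradient f u \<bullet> u - F u)"
proof (rule antisym)
  show "fenchel f (gradient f u) \<le> ereal (gradient f u \<bullet> u - F u)"
    unfolding fenchel_def
  proof (rule SUP_least)
    fix v
    show "ereal (gradient f u \<bullet> v) - f v \<le> ereal (gradient f u \<bullet> u - F u)"
    proof (cases "v \<in> interior K")
      case True
      then show ?thesis using F_gradient_le[OF u True] f_interior[OF True]
        by (cases "f v") (auto simp: inner_diff_right)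
    qed (simp add: f_exterior)
  qed
qed (rule fenchel_f_ge[OF u])

text \<open>Equality in the Fenchel-Young inequality makes \<open>u\<close> a maximizer of \<open>\<langle>y, v\<rangle> - f v\<close>, hence a
  critical point.\<close>

lemma maximizer_imp_gradient:
  assumes u: "u \<in> interior K" and max: "\<And>v. v \<in> interior K \<Longrightarrow> y \<bullet> v - F v \<le> y \<bullet> u - F u"
  shows "y = gradient f u"
proof -
  have "((\<lambda>v. y \<bullet> v - F v) has_derivative (\<lambda>p. y \<bullet> p - p \<bullet> gradient f u)) (at u)"
    using GDERIV_F[OF u] unfolding gderiv_def by (auto intro!: derivative_eq_intros)
  then have "(\<lambda>p. y \<bullet> p - p \<bullet> gradient f u) = (\<lambda>v. 0)"
    using differential_zero_maxmin[OF u open_interior] max by blast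
  then have "\<forall>p. p \<bullet> y = p \<bullet> gradient f u"
    by (metis eq_iff_diff_eq_0 inner_commute)
  then show ?thesis by (simp only: vector_eq_ldot)
qed

lemma fenchel_f_eq_imp_gradient:
  assumes u: "u \<in> interior K" and eq: "fenchel f y \<le> ereal (y \<bullet> u - F u)"
  shows "y = gradient f u"
proof (rule maximizer_imp_gradient[OF u])
  fix v assume "v \<in> interior K"
  then have "ereal (y \<bullet> v - F v) \<le> ereal (y \<bullet> u - F u)"
    using fenchel_f_ge eq order_trans by blast
  then show "y \<bullet> v - F v \<le> y \<bullet> u - F u" by simp
qed

lemma inj_on_gradient: "inj_on (gradient f) (interior K)"
  using gradient_strict_mono by (fastforce simp: inj_on_def)

text \<open>The gradient map is continuous and injective, so by invariance of domain it is a
  homeomorphism onto an open set. For \<open>y = \<nabla>f(u)\<close> and \<open>y' = \<nabla>f(u')\<close>, two applications of the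
  Fenchel-Young inequality show that \<open>f\<^sup>* y'\<close> exceeds \<open>f\<^sup>* y + \<langle>u, y' - y\<rangle>\<close> by an amount between
  zero and \<open>\<langle>y' - y, u' - u\<rangle>\<close>. Since \<open>u'\<close> depends continuously on \<open>y'\<close>, this is of smaller
  order than \<open>y' - y\<close>.\<close>

lemma gradient_fenchel_gradient:
  assumes u: "u \<in> interior K"
  shows "gradient (fenchel f) (gradient f u) = u"
proof (rule gradient_eqI)
  define y where "y = gradient f u"
  have cont: "continuous_on (interior K) (gradient f)"
    using gradient_has_derivative_hessian has_derivative_continuous continuous_at_imp_continuous_on
    by blast
  obtain \<eta> where \<eta>: "homeomorphism (interior K) (gradient f ` interior K) (gradient f) \<eta>"
    using invariance_of_domain_homeomorphism[OF open_interior cont _ inj_on_gradient] by auto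
  have op: "open (gradient f ` interior K)"
    using invariance_of_domain[OF cont open_interior inj_on_gradient] .
  have y_in: "y \<in> gradient f ` interior K" using u by (simp add: y_def)
  have \<eta>y: "\<eta> y = u" using \<eta> u by (simp add: homeomorphism_def y_def)
  have "continuous_on (gradient f ` interior K) \<eta>" using \<eta> by (simp add: homeomorphism_def)
  then have \<eta>_cont: "isCont \<eta> y" using op y_in continuous_on_eq_continuous_at by blast
  have excess: "0 \<le> real_of_ereal (fenchel f y') - real_of_ereal (fenchel f y) - (y' - y) \<bullet> u"
      "real_of_ereal (fenchel f y') - real_of_ereal (fenchel f y) - (y' - y) \<bullet> u
        \<le> (y' - y) \<bullet> (\<eta> y' - u)" if "y' \<in> gradient f ` interior K" for y'
  proof -
    obtain u' where u': "u' \<in> interior K" "y' = gradient f u'" using \<open>y' \<in> _\<close> by blast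
    have "\<eta> y' = u'" using \<eta> u' by (simp add: homeomorphism_def)
    moreover have "fenchel f y = ereal (y \<bullet> u - F u)" "fenchel f y' = ereal (y' \<bullet> u' - F u')"
      using fenchel_f_gradient u u' by (auto simp: y_def)
    moreover have "y' \<bullet> u - F u \<le> y' \<bullet> u' - F u'" "y \<bullet> u' - F u' \<le> y \<bullet> u - F u"
      using F_gradient_le[OF u u'(1)] F_gradient_le[OF u'(1) u] u'(2)
      by (simp_all add: y_def inner_diff_right)
    ultimately show "0 \<le> real_of_ereal (fenchel f y') - real_of_ereal (fenchel f y) - (y' - y) \<bullet> u"
      "real_of_ereal (fenchel f y') - real_of_ereal (fenchel f y) - (y' - y) \<bullet> u
        \<le> (y' - y) \<bullet> (\<eta> y' - u)"
      by (simp_all add: inner_diff_left inner_diff_right)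
  qed
  have "GDERIV (\<lambda>v. real_of_ereal (fenchel f v)) y :> u"
    unfolding gderiv_def has_derivative_at_alt
  proof (intro conjI allI impI)
    show "bounded_linear (\<lambda>p. p \<bullet> u)" by (rule bounded_linear_inner_left)
    fix e :: real assume "0 < e"
    obtain d1 where d1: "0 < d1" "ball y d1 \<subseteq> gradient f ` interior K"
      using op y_in open_contains_ball by blast
    obtain d2 where d2: "0 < d2" "\<And>y'. dist y' y < d2 \<Longrightarrow> dist (\<eta> y') (\<eta> y) < e"
      using \<eta>_cont \<open>0 < e\<close> unfolding continuous_at_eps_delta by metis
    have "norm (real_of_ereal (fenchel f y') - real_of_ereal (fenchel f y) - (y' - y) \<bullet> u)
        \<le> e * norm (y' - y)" if "norm (y' - y) < min d1 d2" for y'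
    proof -
      have y': "y' \<in> gradient f ` interior K"
        using that d1(2) by (auto simp: dist_norm norm_minus_commute subset_eq)
      have "norm (\<eta> y' - u) \<le> e"
        using d2(2)[of y'] that \<eta>y by (simp add: dist_norm)
      then have "norm (y' - y) * norm (\<eta> y' - u) \<le> norm (y' - y) * e"
        by (rule mult_left_mono) simp
      then have "(y' - y) \<bullet> (\<eta> y' - u) \<le> e * norm (y' - y)"
        using norm_cauchy_schwarz[of "y' - y" "\<eta> y' - u"] by (simp add: mult.commute)
      then show ?thesis using excess[OF y'] by simp
    qed
    then show "\<exists>d>0. \<forall>y'. norm (y' - y) < d \<longrightarrow>
        norm (real_of_ereal (fenchel f y') - real_of_ereal (fenchel f y) - (y' - y) \<bullet> u)
        \<le> e * norm (y' - y)"
      using d1(1) d2(1) by (intro exI[of _ "min d1 d2"]) auto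
  qed
  then show "GDERIV (\<lambda>v. real_of_ereal (fenchel f v)) (gradient f u) :> u" by (simp add: y_def)
qed

text \<open>Moving out along a direction \<open>w\<close> in the interior of the cone sends \<open>f\<close> to minus infinity
  logarithmically, whereas a nonnegative slope at \<open>u\<close> would keep it bounded below by a tangent.\<close>

lemma gradient_neg_interior:
  assumes u: "u \<in> interior K" and w: "w \<in> interior K"
  shows "gradient f u \<bullet> w < 0"
proof (rule ccontr)
  assume "\<not> ?thesis"
  then have nonneg: "0 \<le> gradient f u \<bullet> w" by simp
  define a where "a = F w - F u + gradient f u \<bullet> u"
  define t where "t = exp ((a + 1) / \<theta>)"
  have t: "0 < t" "\<theta> * ln t = a + 1" using theta by (simp_all add: t_def)
  have "F u + gradient f u \<bullet> (t *\<^sub>R w - u) \<le> F w - \<theta> * ln t"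
    using F_gradient_le[OF u scale_interior(1)[OF w t(1)]] scale_interior(2)[OF w t(1)] by simp
  then have "t * (gradient f u \<bullet> w) \<le> - 1" using t(2) by (simp add: inner_diff_right a_def)
  moreover have "0 \<le> t * (gradient f u \<bullet> w)" using nonneg t(1) by simp
  ultimately show False by simp
qed

text \<open>The cone is the closure of its interior, so the weak inequality holds on all of \<open>K\<close>, at
  every base point. The slope in direction \<open>w\<close> increases strictly from \<open>u\<close> to \<open>u + w\<close>, and as it
  is still nonpositive there, it is negative at \<open>u\<close>.\<close>

lemma gradient_neg:
  assumes u: "u \<in> interior K" and w: "w \<in> K" "w \<noteq> 0"
  shows "gradient f u \<bullet> w < 0"
proof -
  have uw: "u + w \<in> interior K" by (rule add_interior[OF u w(1)])
  have "closed {v. gradient f (u + w) \<bullet> v \<le> 0}" by (rule closed_halfspace_le)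
  moreover have "interior K \<subseteq> {v. gradient f (u + w) \<bullet> v \<le> 0}"
    using gradient_neg_interior[OF uw] by (auto intro: less_imp_le)
  ultimately have "closure (interior K) \<subseteq> {v. gradient f (u + w) \<bullet> v \<le> 0}"
    by (rule closure_minimal[rotated])
  moreover have "closure (interior K) = K"
    using cone convex_closure_interior[of K] by (simp add: regular_cone_def)
  ultimately have "gradient f (u + w) \<bullet> w \<le> 0" using w(1) by blast
  then show ?thesis using gradient_strict_mono[OF u uw] w(2) by simp
qed

text \<open>On the compact set of unit vectors of \<open>K\<close> the negative quantity \<open>\<langle>\<nabla>f(u), w\<rangle>\<close> is bounded
  away from zero, which leaves room for a ball around \<open>\<nabla>f(u)\<close> inside the polar cone.\<close>

lemma gradient_in_interior_polar:
  assumes u: "u \<in> interior K"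
  shows "gradient f u \<in> interior (polar_cone K)"
proof -
  define S where "S = K \<inter> sphere 0 1"
  have "compact S" using cone unfolding S_def regular_cone_def
    by (metis closed_Int_compact compact_sphere)
  have "\<exists>c>0. \<forall>w\<in>S. gradient f u \<bullet> w \<le> - c"
  proof (cases "S = {}")
    case True
    then show ?thesis by (intro exI[of _ 1]) auto
  next
    case False
    then obtain w0 where w0: "w0 \<in> S" "\<And>w. w \<in> S \<Longrightarrow> gradient f u \<bullet> w \<le> gradient f u \<bullet> w0"
      using continuous_attains_sup[OF \<open>compact S\<close> False, of "\<lambda>w. gradient f u \<bullet> w"]
        continuous_on_inner[OF continuous_on_const continuous_on_id] by metis
    moreover have "gradient f u \<bullet> w0 < 0" using w0(1) gradient_neg[OF u, of w0] by (force simp: S_def)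
    ultimately show ?thesis by (intro exI[of _ "- (gradient f u \<bullet> w0)"]) auto
  qed
  then obtain c where c: "0 < c" "\<And>w. w \<in> S \<Longrightarrow> gradient f u \<bullet> w \<le> - c" by blast
  have "ball (gradient f u) c \<subseteq> polar_cone K"
  proof
    fix y assume y: "y \<in> ball (gradient f u) c"
    have "y \<bullet> w \<le> 0" if w: "w \<in> K" for w
    proof (cases "w = 0")
      case False
      define e where "e = inverse (norm w) *\<^sub>R w"
      have "e \<in> S" using cone w False unfolding S_def e_def regular_cone_def Convex.cone_def by auto
      then have e: "norm e = 1" "gradient f u \<bullet> e \<le> - c" using c(2) by (auto simp: S_def)
      have "(y - gradient f u) \<bullet> e \<le> norm (y - gradient f u) * norm e" by (rule norm_cauchy_schwarz)
      also have "\<dots> < c" using y e(1) by (simp add: dist_norm norm_minus_commute)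
      finally have "y \<bullet> e \<le> 0" using e(2) by (simp add: inner_diff_left)
      then have "norm w * (y \<bullet> e) \<le> 0" by (simp add: mult_nonneg_nonpos)
      moreover have "norm w * (y \<bullet> e) = y \<bullet> w" using False by (simp add: e_def)
      ultimately show ?thesis by simp
    qed simp
    then show "y \<in> polar_cone K" by (simp add: polar_cone_def)
  qed
  then show ?thesis using c(1) interior_maximal[of "ball (gradient f u) c"] centre_in_ball open_ball
    by blast
qed

text \<open>For \<open>y\<close> in the interior of the polar cone, \<open>\<langle>y, v\<rangle>\<close> is at most \<open>- c * norm v\<close> on \<open>K\<close>. By
  logarithmic homogeneity \<open>f\<close> has affine minorants of arbitrarily small slope, so \<open>\<langle>y, v\<rangle> - f v\<close>
  has bounded superlevel sets. They are closed because \<open>f\<close> tends to infinity at the boundary.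
  Hence a maximizer exists, and \<open>y\<close> is the gradient there.\<close>

lemma interior_polar_imp_gradient:
  assumes y: "y \<in> interior (polar_cone K)"
  obtains u where "u \<in> interior K" "y = gradient f u"
proof -
  obtain u0 where u0: "u0 \<in> interior K" using cone by (auto simp: regular_cone_def)
  define L where "L = (\<lambda>v. y \<bullet> v - F v)"
  define T where "T = {v \<in> interior K. L u0 \<le> L v}"
  obtain c where c: "0 < c" "cball y c \<subseteq> polar_cone K"
    using y mem_interior_cball by blast
  have decay: "y \<bullet> v \<le> - c * norm v" if v: "v \<in> K" for v
  proof (cases "v = 0")
    case False
    have "y + (c / norm v) *\<^sub>R v \<in> cball y c" using c(1) False by (simp add: dist_norm)
    then have "(y + (c / norm v) *\<^sub>R v) \<bullet> v \<le> 0" using c(2) v unfolding polar_cone_def by blast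
    moreover have "(c / norm v) *\<^sub>R v \<bullet> v = c * norm v"
      using False by (simp add: power2_norm_eq_inner[symmetric] power2_eq_square)
    ultimately show ?thesis by (simp add: inner_add_left)
  qed simp
  \<comment> \<open>The tangent of \<open>f\<close> at \<open>t *\<^sub>R u0\<close> has slope \<open>\<nabla>f(u0) / t\<close>. This \<open>t\<close> makes it at most half the
    decay rate \<open>c\<close>.\<close>
  define t where "t = 2 * norm (gradient f u0) / c + 1"
  have "0 \<le> 2 * norm (gradient f u0) / c" using c(1) by simp
  then have t: "0 < t" unfolding t_def by linarith
  define C where "C = \<theta> * ln t - F u0 + gradient f u0 \<bullet> u0"
  have L_le: "L v \<le> C - c / 2 * norm v" if v: "v \<in> interior K" for v
  proof -
    have it: "0 < inverse t" using t by simp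
    have "F u0 + gradient f u0 \<bullet> (inverse t *\<^sub>R v - u0) \<le> F v - \<theta> * ln (inverse t)"
      using F_gradient_le[OF u0 scale_interior(1)[OF v it]] scale_interior(2)[OF v it] by simp
    then have F_ge: "- C + inverse t * (gradient f u0 \<bullet> v) \<le> F v"
      using t by (simp add: C_def ln_inverse inner_diff_right)
    have "norm (gradient f u0) \<le> c / 2 * t" using c(1) by (simp add: t_def field_simps)
    then have "inverse t * norm (gradient f u0) \<le> c / 2" using t by (simp add: field_simps)
    then have "inverse t * norm (gradient f u0) * norm v \<le> c / 2 * norm v"
      by (rule mult_right_mono) simp
    moreover have "inverse t * - (norm (gradient f u0) * norm v) \<le> inverse t * (gradient f u0 \<bullet> v)"
      using Cauchy_Schwarz_ineq2[of "gradient f u0" v] it by (intro mult_left_mono) auto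
    moreover have "y \<bullet> v \<le> - c * norm v" using decay v interior_subset by blast
    ultimately show ?thesis using F_ge by (simp add: L_def algebra_simps)
  qed
  have "bounded T"
  proof (rule boundedI)
    fix v assume "v \<in> T"
    then have "L u0 \<le> C - c / 2 * norm v" using L_le by (force simp: T_def)
    then show "norm v \<le> 2 * (C - L u0) / c" using c(1) by (simp add: field_simps)
  qed
  moreover have "closed T"
    unfolding closed_sequential_limits
  proof (intro allI impI, elim conjE)
    fix s v assume s: "\<forall>k. s k \<in> T" "s \<longlonglongrightarrow> v"
    have s_in: "s k \<in> interior K" "L u0 \<le> L (s k)" for k using s(1) by (auto simp: T_def)
    have "v \<in> interior K"
    proof (rule ccontr)
      assume "v \<notin> interior K"
      moreover have "v \<in> closure (interior K)" using s(2) s_in closure_sequential by blast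
      ultimately have "v \<in> frontier K"
        using closure_mono[OF interior_subset] unfolding frontier_def by blast
      then have blowup: "(\<lambda>k. f (s k)) \<longlonglongrightarrow> \<infinity>"
        using barrier s_in s(2) unfolding lh_sc_barrier_def by blast
      have "(\<lambda>k. y \<bullet> s k - L u0) \<longlonglongrightarrow> y \<bullet> v - L u0" by (intro tendsto_intros s(2))
      then have "(\<lambda>k. ereal (y \<bullet> s k - L u0)) \<longlonglongrightarrow> ereal (y \<bullet> v - L u0)" by simp
      moreover have "f (s k) \<le> ereal (y \<bullet> s k - L u0)" for k
        using s_in(2)[of k] f_interior[OF s_in(1)[of k]]
        by (metis (no_types) L_def diff_le_eq le_diff_eq add.commute ereal_less_eq(3))
      ultimately have "\<infinity> \<le> ereal (y \<bullet> v - L u0)"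
        using LIMSEQ_le[OF blowup] by blast
      then show False by simp
    qed
    moreover have "L u0 \<le> L v"
    proof (rule Lim_bounded2)
      show "(\<lambda>k. L (s k)) \<longlonglongrightarrow> L v" unfolding L_def
        by (rule tendsto_diff[OF tendsto_inner[OF tendsto_const s(2)]
            isCont_tendsto_compose[OF isCont_F[OF \<open>v \<in> interior K\<close>] s(2)]])
    qed (use s_in in auto)
    ultimately show "v \<in> T" by (simp add: T_def)
  qed
  ultimately have "compact T" by (simp add: compact_eq_bounded_closed)
  moreover have "u0 \<in> T" using u0 by (simp add: T_def)
  moreover have "continuous_on T L" unfolding L_def T_def
    using isCont_F by (auto intro!: continuous_intros continuous_at_imp_continuous_on)
  ultimately obtain u where u: "u \<in> T" "\<And>v. v \<in> T \<Longrightarrow> L v \<le> L u"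
    using continuous_attains_sup[of T L] by blast
  have "L v \<le> L u" if "v \<in> interior K" for v
    using u that by (cases "L u0 \<le> L v") (auto simp: T_def)
  then show ?thesis using that u(1) maximizer_imp_gradient[of u y] by (auto simp: T_def L_def)
qed

end

section \<open>The mirror descent step\<close>

lemma is_arg_min_iff_eq_strict_minimizer:
  fixes \<Phi> :: "'a \<Rightarrow> 'b::linorder"
  assumes "\<And>x. x \<noteq> m \<Longrightarrow> \<Phi> m < \<Phi> x"
  shows "is_arg_min \<Phi> (\<lambda>_. True) x \<longleftrightarrow> x = m"
proof
  assume "is_arg_min \<Phi> (\<lambda>_. True) x"
  then show "x = m" using assms[of x] by (auto simp: is_arg_min_def)
next
  assume "x = m"
  then show "is_arg_min \<Phi> (\<lambda>_. True) x"
    using assms unfolding is_arg_min_def by (metis less_asym less_irrefl)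
qed

context regular_cone_barrier
begin

text \<open>Up to an additive constant and the factor \<open>1 / \<gamma>\<close>, the objective of the mirror step is
  \<open>f\<^sup>* y' - \<langle>y', u - \<gamma> p\<rangle>\<close>. Its minimizer is determined by equality in the Fenchel-Young
  inequality at the primal point \<open>u - \<gamma> p\<close>. For \<open>\<gamma> = 0\<close> the objective is infinite off
  \<open>\<nabla>f(u)\<close> because the Bregman distance vanishes only there.\<close>

lemma mirror_step_iff:
  assumes u: "u \<in> interior K" and u': "u - \<gamma> *\<^sub>R p \<in> interior K" and \<gamma>: "0 \<le> \<gamma>"
  shows "is_arg_min
      (\<lambda>y'. ereal (p \<bullet> y') + inverse (ereal \<gamma>) * bregman (fenchel f) y' (gradient f u))
      (\<lambda>_. True) y \<longleftrightarrow> y = gradient f (u - \<gamma> *\<^sub>R p)"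
proof (rule is_arg_min_iff_eq_strict_minimizer)
  define B where "B = (\<lambda>y'. bregman (fenchel f) y' (gradient f u))"
  define u1 where "u1 = u - \<gamma> *\<^sub>R p"
  have u1: "u1 \<in> interior K" using u' by (simp add: u1_def)
  have B_eq: "B y' = fenchel f y' - ereal (u \<bullet> y' - F u)" for y'
    unfolding B_def bregman_def fenchel_f_gradient[OF u] gradient_fenchel_gradient[OF u]
    by (cases "fenchel f y'") (auto simp: inner_diff_right inner_commute)
  have young: "u1 \<bullet> y' - F u1 < r" if "fenchel f y' = ereal r" "y' \<noteq> gradient f u1" for y' r
    using fenchel_f_eq_imp_gradient[OF u1, of y'] that by (force simp: inner_commute)
  have not_MInf: "fenchel f y' \<noteq> - \<infinity>" for y'
    using fenchel_f_ge[OF u, of y'] by auto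
  fix y' assume y': "y' \<noteq> gradient f (u - \<gamma> *\<^sub>R p)"
  have "ereal (p \<bullet> gradient f u1) + inverse (ereal \<gamma>) * B (gradient f u1)
      < ereal (p \<bullet> y') + inverse (ereal \<gamma>) * B y'"
  proof (cases "\<gamma> = 0")
    case True
    then have "u1 = u" by (simp add: u1_def)
    have "B (gradient f u) = 0"
      by (simp add: B_eq fenchel_f_gradient[OF u] inner_commute flip: zero_ereal_def)
    moreover have "0 < B y'"
      using young[of y'] not_MInf[of y'] y' \<open>u1 = u\<close> unfolding u1_def[symmetric]
      by (cases "fenchel f y'") (auto simp: B_eq)
    ultimately show ?thesis using True \<open>u1 = u\<close> by (auto simp flip: zero_ereal_def)
  next
    case False
    then have \<gamma>: "0 < \<gamma>" using \<gamma> by simp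
    have at_real: "ereal (p \<bullet> w) + inverse (ereal \<gamma>) * B w = ereal ((r - u1 \<bullet> w + F u) / \<gamma>)"
      if "fenchel f w = ereal r" for w r
      using \<gamma> that by (simp add: B_eq u1_def inner_diff_left field_simps)
    have "ereal (p \<bullet> gradient f u1) + inverse (ereal \<gamma>) * B (gradient f u1)
        = ereal ((F u - F u1) / \<gamma>)"
      using at_real[OF fenchel_f_gradient[OF u1]] by (simp add: inner_commute)
    moreover have "ereal ((F u - F u1) / \<gamma>) < ereal (p \<bullet> y') + inverse (ereal \<gamma>) * B y'"
    proof (cases "fenchel f y'")
      case (real r)
      then have "F u - F u1 < r - u1 \<bullet> y' + F u" using young[of y' r] y' by (simp add: u1_def)
      then show ?thesis unfolding at_real[OF real] using \<gamma> by (simp add: divide_strict_right_mono)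
    next
      case PInf
      then show ?thesis using \<gamma> by (simp add: B_eq)
    qed (use not_MInf in auto)
    ultimately show ?thesis by simp
  qed
  then show "ereal (p \<bullet> gradient f (u - \<gamma> *\<^sub>R p)) +
        inverse (ereal \<gamma>) * bregman (fenchel f) (gradient f (u - \<gamma> *\<^sub>R p)) (gradient f u)
      < ereal (p \<bullet> y') + inverse (ereal \<gamma>) * bregman (fenchel f) y' (gradient f u)"
    by (simp add: B_def u1_def)
qed

end

section \<open>Equivalence of single steps\<close>

definition frank_wolfe_step where
  "frank_wolfe_step f A h x v G D \<alpha> x' \<longleftrightarrow>
     is_arg_min (\<lambda>x'. ereal (gradient f (A x) \<bullet> A x') + h x') (\<lambda>_. True) v \<and>
     ereal G = ereal (gradient f (A x) \<bullet> A (x - v)) + h x - h v \<and>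
     D = local_norm f (A x) (A (v - x)) \<and>
     \<alpha> = step_size G D \<and>
     x' = x + \<alpha> *\<^sub>R (v - x)"

definition mirror_descent_step where
  "mirror_descent_step f A h y z s g G D \<gamma> y' z' \<longleftrightarrow>
     s \<in> subdiff (fenchel h) (- adjoint A y) \<and>
     g = gradient (fenchel f) y - A s \<and>
     z' = (1 - \<gamma>) *\<^sub>R z + \<gamma> *\<^sub>R s \<and>
     ereal G = ereal (g \<bullet> y) + h z - h s \<and>
     D = local_norm f (gradient (fenchel f) y) g \<and>
     \<gamma> = step_size G D \<and>
     is_arg_min (\<lambda>y'. ereal (g \<bullet> y') + inverse (ereal \<gamma>) * bregman (fenchel f) y' y)
       (\<lambda>_. True) y'"

lemma frank_wolfe_run_iff_steps:
  "frank_wolfe_run f A h x v G D \<alpha> \<longleftrightarrow> x 0 \<in> edom h \<and> A (x 0) \<in> edom f \<and>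
     (\<forall>k. frank_wolfe_step f A h (x k) (v k) (G k) (D k) (\<alpha> k) (x (Suc k)))"
  by (simp add: frank_wolfe_run_def frank_wolfe_step_def)

lemma mirror_descent_run_iff_steps:
  "mirror_descent_run K f A h y z s g G D \<gamma> \<longleftrightarrow>
     y 0 \<in> interior (polar_cone K) \<and> z 0 \<in> edom h \<and> A (z 0) = gradient (fenchel f) (y 0) \<and>
     (\<forall>k. mirror_descent_step f A h (y k) (z k) (s k) (g k) (G k) (D k) (\<gamma> k)
       (y (Suc k)) (z (Suc k)))"
  by (simp add: mirror_descent_run_def mirror_descent_step_def)

lemma local_norm_scaleR: "local_norm f u (c *\<^sub>R w) = \<bar>c\<bar> * local_norm f u w"
proof -
  have "(c *\<^sub>R w) \<bullet> (hessian f u *v (c *\<^sub>R w)) = c\<^sup>2 * (w \<bullet> (hessian f u *v w))"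
    by (simp add: matrix_vector_mult_scaleR power2_eq_square)
  then show ?thesis by (simp add: local_norm_def real_sqrt_mult)
qed

locale composite_problem = regular_cone_barrier K \<theta> f
  for K :: "(real^'m) set" and \<theta> and f +
  fixes A :: "real^'n \<Rightarrow> real^'m" and h :: "real^'n \<Rightarrow> ereal"
  assumes linear_A: "linear A"
    and proper_h: "proper h" and closed_h: "closed_fun h" and convex_h: "convex_fun h"
    and convex_edom_h: "convex (edom h)"
begin

lemma linear_oracle_iff:
  "s \<in> subdiff (fenchel h) (- adjoint A y) \<longleftrightarrow>
    is_arg_min (\<lambda>x. ereal (y \<bullet> A x) + h x) (\<lambda>_. True) s"
proof -
  have "- (- adjoint A y) \<bullet> x = y \<bullet> A x" for x
    using adjoint_works[OF linear_A, of x y] by (simp add: inner_commute)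
  then show ?thesis
    using subdiff_fenchel_iff_is_arg_min[OF proper_h closed_h convex_h, of s "- adjoint A y"]
    by simp
qed

lemma frank_wolfe_step_feasible:
  assumes x: "x \<in> edom h" "A x \<in> interior K"
    and step: "frank_wolfe_step f A h x v G D \<alpha> x'"
  shows "0 \<le> \<alpha>" "x' \<in> edom h" "A x' \<in> interior K"
proof -
  let ?y = "gradient f (A x)"
  have v: "is_arg_min (\<lambda>x'. ereal (?y \<bullet> A x') + h x') (\<lambda>_. True) v"
    and G: "ereal G = ereal (?y \<bullet> A (x - v)) + h x - h v"
    and D: "D = local_norm f (A x) (A (v - x))"
    and \<alpha>: "\<alpha> = step_size G D" and x': "x' = x + \<alpha> *\<^sub>R (v - x)"
    using step by (auto simp: frank_wolfe_step_def)
  have A_diff: "A (a - b) = A a - A b" for a b by (rule linear_diff[OF linear_A])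
  have min: "ereal (?y \<bullet> A v) + h v \<le> ereal (?y \<bullet> A x) + h x"
    using v by (auto simp: is_arg_min_def not_less)
  obtain r where r: "h x = ereal r"
    using x(1) proper_h by (cases "h x") (auto simp: edom_def proper_def)
  then obtain t where t: "h v = ereal t"
    using min proper_h by (cases "h v") (auto simp: proper_def)
  have "0 \<le> G" using G min r t by (simp add: A_diff inner_diff_right)
  moreover have "0 \<le> D" using curvature_nonneg[OF x(2)] by (simp add: D local_norm_def)
  ultimately have bounds: "0 \<le> \<alpha>" "\<alpha> \<le> 1" "\<alpha> * D < 1"
    using step_size_bounds \<alpha> by blast+
  show "0 \<le> \<alpha>" by fact
  have "v \<in> edom h" using t by (simp add: edom_def)
  moreover have "x' = (1 - \<alpha>) *\<^sub>R x + \<alpha> *\<^sub>R v"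
    by (simp add: x' scaleR_diff_left scaleR_diff_right)
  ultimately show "x' \<in> edom h" using convex_edom_h x(1) bounds by (auto intro: convexD_alt)
  have "A x + \<alpha> *\<^sub>R A (v - x) \<in> interior K"
    using bounds by (intro Dikin_ellipsoid[OF x(2)]) (simp add: local_norm_scaleR flip: D)
  then show "A x' \<in> interior K"
    by (simp add: x' linear_add[OF linear_A] linear_cmul[OF linear_A])
qed

text \<open>With the dual iterate \<open>y = \<nabla>f(A x)\<close> and \<open>\<nabla>f\<^sup>*(y) = A x\<close>, the subgradient of \<open>h\<^sup>*\<close> is a
  solution of the linearized problem, both gaps and both norms agree because \<open>g = - A (v - x)\<close>, and
  the minimizer of the mirror step is the gradient at \<open>A x - \<alpha> g = A x'\<close>.\<close>

lemma mirror_descent_step_iff: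
  assumes x: "x \<in> edom h" "A x \<in> interior K"
  shows "mirror_descent_step f A h (gradient f (A x)) x v g G D \<alpha> y' x' \<longleftrightarrow>
    g = A x - A v \<and> frank_wolfe_step f A h x v G D \<alpha> x' \<and> y' = gradient f (A x')"
proof -
  have x'_eq: "(1 - \<alpha>) *\<^sub>R x + \<alpha> *\<^sub>R v = x + \<alpha> *\<^sub>R (v - x)"
    by (simp add: scaleR_diff_left scaleR_diff_right)
  have norm_eq: "local_norm f (A x) (A x - A v) = local_norm f (A x) (A (v - x))"
    using local_norm_scaleR[of f "A x" "- 1" "A (v - x)"]
    by (simp add: linear_diff[OF linear_A])
  have gap_eq: "(A x - A v) \<bullet> gradient f (A x) = gradient f (A x) \<bullet> A (x - v)"
    by (simp add: linear_diff[OF linear_A] inner_commute)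
  let ?prox = "is_arg_min (\<lambda>y'. ereal ((A x - A v) \<bullet> y') +
    inverse (ereal \<alpha>) * bregman (fenchel f) y' (gradient f (A x))) (\<lambda>_. True) y'"
  have "mirror_descent_step f A h (gradient f (A x)) x v g G D \<alpha> y' x' \<longleftrightarrow>
      g = A x - A v \<and> frank_wolfe_step f A h x v G D \<alpha> x' \<and> ?prox"
    unfolding mirror_descent_step_def frank_wolfe_step_def linear_oracle_iff
      gradient_fenchel_gradient[OF x(2)]
    by (auto simp: x'_eq norm_eq gap_eq)
  moreover have "?prox \<longleftrightarrow> y' = gradient f (A x')"
    if step: "frank_wolfe_step f A h x v G D \<alpha> x'"
  proof -
    have "A x' = A x - \<alpha> *\<^sub>R (A x - A v)"
      using step by (simp add: frank_wolfe_step_def linear_add[OF linear_A]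
          linear_cmul[OF linear_A] linear_diff[OF linear_A] scaleR_diff_right)
    then show ?thesis
      using mirror_step_iff[OF x(2), of \<alpha> "A x - A v"] frank_wolfe_step_feasible[OF x step] by simp
  qed
  ultimately show ?thesis by blast
qed

section \<open>Equivalence of runs\<close>

lemma frank_wolfe_run_imp_mirror_descent_run:
  assumes run: "frank_wolfe_run f A h x v G D \<alpha>"
  shows "mirror_descent_run K f A h (\<lambda>k. gradient f (A (x k))) x v (\<lambda>k. A (x k) - A (v k)) G D \<alpha>"
proof -
  have start: "x 0 \<in> edom h" "A (x 0) \<in> interior K"
    and step: "\<And>k. frank_wolfe_step f A h (x k) (v k) (G k) (D k) (\<alpha> k) (x (Suc k))"
    using run by (auto simp: frank_wolfe_run_iff_steps edom_f)
  have feasible: "x k \<in> edom h \<and> A (x k) \<in> interior K" for k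
    by (induction k) (use start step frank_wolfe_step_feasible in blast)+
  then show ?thesis
    unfolding mirror_descent_run_iff_steps
    using start step mirror_descent_step_iff gradient_in_interior_polar gradient_fenchel_gradient
    by simp
qed

text \<open>As a point of the interior of the polar cone, \<open>y 0\<close> is a gradient of \<open>f\<close>, and \<open>A (z 0)\<close> is the
  unique point of the interior of the cone at which it is attained. So \<open>z 0\<close> is an admissible
  start of the Frank-Wolfe method.\<close>

lemma mirror_descent_run_imp_frank_wolfe_run:
  assumes run: "mirror_descent_run K f A h y z s g G D \<gamma>"
  shows "frank_wolfe_run f A h z s G D \<gamma>" "y k = gradient f (A (z k))"
proof -
  have start: "y 0 \<in> interior (polar_cone K)" "z 0 \<in> edom h" "A (z 0) = gradient (fenchel f) (y 0)"
    and step: "\<And>k. mirror_descent_step f A h (y k) (z k) (s k) (g k) (G k) (D k) (\<gamma> k)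
      (y (Suc k)) (z (Suc k))"
    using run by (auto simp: mirror_descent_run_iff_steps)
  obtain u where u: "u \<in> interior K" "y 0 = gradient f u"
    using interior_polar_imp_gradient[OF start(1)] .
  then have Az0: "A (z 0) = u" using start(3) gradient_fenchel_gradient by simp
  have inv: "z k \<in> edom h \<and> A (z k) \<in> interior K \<and> y k = gradient f (A (z k))" for k
  proof (induction k)
    case 0
    then show ?case using start u Az0 by simp
  next
    case (Suc k)
    then show ?case
      using step[of k] mirror_descent_step_iff frank_wolfe_step_feasible by metis
  qed
  then show "y k = gradient f (A (z k))" by blast
  have "frank_wolfe_step f A h (z k) (s k) (G k) (D k) (\<gamma> k) (z (Suc k))" for k
    using inv[of k] step[of k] mirror_descent_step_iff by metis
  then show "frank_wolfe_run f A h z s G D \<gamma>"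
    using inv[of 0] by (simp add: frank_wolfe_run_iff_steps edom_f)
qed

end

theorem theorem3p1:
  fixes K :: "(real^'m) set"
    and f :: "real^'m \<Rightarrow> ereal"
    and \<theta> :: real
    and A :: "real^'n \<Rightarrow> real^'m"
    and h :: "real^'n \<Rightarrow> ereal"
    and x0 z0 :: "real^'n"
    and y0 :: "real^'m"
  assumes "regular_cone K"
    and "\<theta> \<ge> 1"
    and "lh_sc_barrier \<theta> K f"
    and "linear A"
    and "proper h" "closed_fun h" "convex_fun h"
    and "edom h \<noteq> {}" "convex (edom h)" "compact (edom h)"
    and "A ` edom h \<inter> edom f \<noteq> {}"
    and "x0 = z0"
    and "y0 = gradient f (A x0)"
  shows
    "(\<forall>x v G D \<alpha>.
        frank_wolfe_run f A h x v G D \<alpha> \<and> x 0 = x0 \<longrightarrow>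
        (\<exists>y z s g G' D' \<gamma>.
           mirror_descent_run K f A h y z s g G' D' \<gamma> \<and> y 0 = y0 \<and> z 0 = z0 \<and>
           (\<forall>k. z k = x k \<and> y k = gradient f (A (x k)) \<and> s k = v k \<and>
                G' k = G k \<and> D' k = D k \<and> \<gamma> k = \<alpha> k)))
   \<and> (\<forall>y z s g G' D' \<gamma>.
        mirror_descent_run K f A h y z s g G' D' \<gamma> \<and> y 0 = y0 \<and> z 0 = z0 \<longrightarrow>
        (\<exists>x v G D \<alpha>.
           frank_wolfe_run f A h x v G D \<alpha> \<and> x 0 = x0 \<and>
           (\<forall>k. z k = x k \<and> y k = gradient f (A (x k)) \<and> s k = v k \<and>
                G' k = G k \<and> D' k = D k \<and> \<gamma> k = \<alpha> k)))"
proof -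
  interpret composite_problem K \<theta> f A h
    using assms
    by (intro composite_problem.intro regular_cone_barrier.intro composite_problem_axioms.intro)
  show ?thesis
  proof (intro conjI allI impI; elim conjE)
    fix x v G D \<alpha>
    assume "frank_wolfe_run f A h x v G D \<alpha>" and "x 0 = x0"
    then show "\<exists>y z s g G' D' \<gamma>.
        mirror_descent_run K f A h y z s g G' D' \<gamma> \<and> y 0 = y0 \<and> z 0 = z0 \<and>
        (\<forall>k. z k = x k \<and> y k = gradient f (A (x k)) \<and> s k = v k \<and>
             G' k = G k \<and> D' k = D k \<and> \<gamma> k = \<alpha> k)"
      using frank_wolfe_run_imp_mirror_descent_run assms(12,13) by blast
  next
    fix y z s g G' D' \<gamma>
    assume "mirror_descent_run K f A h y z s g G' D' \<gamma>" and "z 0 = z0"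
    then show "\<exists>x v G D \<alpha>.
        frank_wolfe_run f A h x v G D \<alpha> \<and> x 0 = x0 \<and>
        (\<forall>k. z k = x k \<and> y k = gradient f (A (x k)) \<and> s k = v k \<and>
             G' k = G k \<and> D' k = D k \<and> \<gamma> k = \<alpha> k)"
      using mirror_descent_run_imp_frank_wolfe_run assms(12) by blast
  qed
qed

end
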